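(* Let $p\ge1$ be an integer and let $d_{ij}\ge0$. Define $\alpha,\beta:\mathbb{R}^p\to\mathbb{R}$ by $$\alpha(z)=\frac12\inf_{\|y\|=d_{ij}}\|z-y\|^2,\qquad \beta(z)=\frac12\inf_{\|y\|\le d_{ij}}\|z-y\|^2.$$ Then $\beta$ is the convex envelope of $\alpha$.
   Context: $\|\cdot\|$ is the Euclidean norm on $\mathbb{R}^p$ and $y$ ranges over $\mathbb{R}^p$. The convex envelope (or convex hull) of a function $\gamma$ is its best possible convex underestimator, i.e. the function $$x\mapsto\sup\{\eta(x):\eta\le\gamma,\ \eta\text{ convex}\}.$$ *)

theory Defs
  imports "HOL-Analysis.Analysis"
begin

(* The supremum is taken in ereal, so that a function without any convex
   underestimator gets the envelope -\<infinity> instead of an unspecified real. *)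
definition convex_envelope :: "('a::real_vector \<Rightarrow> real) \<Rightarrow> 'a \<Rightarrow> ereal" where
  "convex_envelope \<gamma> x =
     (SUP \<eta> \<in> {\<eta> :: 'a \<Rightarrow> real. \<eta> \<le> \<gamma> \<and> convex_on UNIV \<eta>}. ereal (\<eta> x))"

(* For d \<ge> 0 both infima below range over nonempty sets and are bounded below by 0. *)
definition alpha :: "real \<Rightarrow> real ^ 'n \<Rightarrow> real" where
  "alpha d z = 1/2 * (INF y \<in> {y. norm y = d}. (norm (z - y))\<^sup>2)"

definition beta :: "real \<Rightarrow> real ^ 'n \<Rightarrow> real" where
  "beta d z = 1/2 * (INF y \<in> {y. norm y \<le> d}. (norm (z - y))\<^sup>2)"

end

theory Submission
  imports Defs
begin

text \<open>
  The function \<open>beta d\<close> equals \<open>\<lambda>z. (max 0 (norm z - d))\<^sup>2 / 2\<close>, which is convex and below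
  \<open>alpha d\<close>. Outside the ball of radius \<open>d\<close> the two functions agree, since the nearest point of
  the ball lies on the sphere. Inside the ball every point lies on a segment joining two antipodal
  points of the sphere, where \<open>alpha d\<close> vanishes, so a convex underestimator is nonpositive there.
\<close>

text \<open>The square is convex on the reals but increasing only on the nonnegative ones, so the
  convexity inequality for \<open>g\<close> can be squared because both of its sides are
  nonnegative.\<close>

lemma convex_on_power2:
  fixes g :: "'a::real_vector \<Rightarrow> real"
  assumes "convex_on S g" and nonneg: "\<And>x. x \<in> S \<Longrightarrow> 0 \<le> g x"
  shows "convex_on S (\<lambda>x. (g x)\<^sup>2)"
proof (rule convex_onI)
  show "convex S"
    using assms(1) by (rule convex_on_imp_convex)
  fix t :: real and x y
  assume t: "0 < t" "t < 1" and xy: "x \<in> S" "y \<in> S"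
  have "(1 - t) *\<^sub>R x + t *\<^sub>R y \<in> S"
    using \<open>convex S\<close> t xy by (simp add: convex_alt)
  moreover have "g ((1 - t) *\<^sub>R x + t *\<^sub>R y) \<le> (1 - t) * g x + t * g y"
    using convex_onD[OF assms(1)] t xy by simp
  ultimately have "(g ((1 - t) *\<^sub>R x + t *\<^sub>R y))\<^sup>2 \<le> ((1 - t) * g x + t * g y)\<^sup>2"
    using nonneg by (simp add: power_mono)
  also have "\<dots> \<le> (1 - t) * (g x)\<^sup>2 + t * (g y)\<^sup>2"
    using convex_onD[OF convex_power2, of t "g x" "g y"] t by simp
  finally show "(g ((1 - t) *\<^sub>R x + t *\<^sub>R y))\<^sup>2 \<le> (1 - t) * (g x)\<^sup>2 + t * (g y)\<^sup>2" .
qed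

lemma bdd_below_image_power2: "bdd_below ((\<lambda>y. (f y :: real)\<^sup>2) ` S)"
  by (rule bdd_belowI[of _ 0]) auto

lemma alpha_le: "norm y = d \<Longrightarrow> alpha d z \<le> 1/2 * (norm (z - y))\<^sup>2"
  unfolding alpha_def by (auto intro!: cINF_lower bdd_below_image_power2)

lemma alpha_sphere:
  assumes "norm z = d"
  shows "alpha d z \<le> 0"
  using alpha_le[OF assms, of z] by simp

text \<open>The point \<open>(d / norm z) *\<^sub>R z\<close> is the radial projection of
  \<open>z\<close> onto the sphere. It serves as the witness for both infima when \<open>z\<close>
  lies outside the ball.\<close>

lemma norm_diff_radial_projection:
  fixes z :: "'a::real_normed_vector"
  assumes "0 \<le> d" "d < norm z"
  shows "norm (z - (d / norm z) *\<^sub>R z) = norm z - d"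
proof -
  have "z - (d / norm z) *\<^sub>R z = (1 - d / norm z) *\<^sub>R z"
    by (simp add: scaleR_diff_left)
  also have "norm \<dots> = \<bar>1 - d / norm z\<bar> * norm z"
    by simp
  also have "\<dots> = norm z - d"
  proof -
    have "0 < norm z"
      using assms by linarith
    then show ?thesis
      using assms by (simp add: left_diff_distrib)
  qed
  finally show ?thesis .
qed

text \<open>The infimum is half the squared distance to the ball. The upper bound is witnessed by
  \<open>z\<close> itself inside the ball and by the radial projection outside; the lower bound is
  the reverse triangle inequality.\<close>

lemma beta_eq:
  fixes z :: "real ^ 'n"
  assumes "d \<ge> 0"
  shows "beta d z = 1/2 * (max 0 (norm z - d))\<^sup>2"
proof -
  have "(INF y \<in> {y. norm y \<le> d}. (norm (z - y))\<^sup>2) = (max 0 (norm z - d))\<^sup>2"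
  proof (rule antisym)
    show "(INF y \<in> {y. norm y \<le> d}. (norm (z - y))\<^sup>2) \<le> (max 0 (norm z - d))\<^sup>2"
    proof (cases "norm z \<le> d")
      case True
      then show ?thesis
        by (intro cINF_lower2[of _ _ z] bdd_below_image_power2) auto
    next
      case False
      then have "norm ((d / norm z) *\<^sub>R z) \<le> d"
        using assms by simp
      then show ?thesis
        using False norm_diff_radial_projection[of d z] assms
        by (intro cINF_lower2[of _ _ "(d / norm z) *\<^sub>R z"] bdd_below_image_power2) auto
    qed
    have "(max 0 (norm z - d))\<^sup>2 \<le> (norm (z - y))\<^sup>2" if "norm y \<le> d" for y
      using norm_triangle_ineq2[of z y] that by (intro power_mono) auto
    then show "(max 0 (norm z - d))\<^sup>2 \<le> (INF y \<in> {y. norm y \<le> d}. (norm (z - y))\<^sup>2)"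
      using assms by (intro cINF_greatest) (auto intro: exI[of _ 0])
  qed
  then show ?thesis
    by (simp add: beta_def)
qed

text \<open>In the closed form of \<open>beta_eq\<close>, the positive part of the convex function
  \<open>norm z - d\<close> is convex and nonnegative, so its square is convex too.\<close>

lemma convex_on_beta:
  assumes "d \<ge> 0"
  shows "convex_on UNIV (beta d :: real ^ 'n \<Rightarrow> real)"
proof -
  have "convex_on UNIV (\<lambda>z :: real ^ 'n. max 0 (norm z - d))"
  proof (rule convex_onI)
    fix t :: real and x y :: "real ^ 'n"
    assume t: "0 < t" "t < 1"
    have "norm ((1 - t) *\<^sub>R x + t *\<^sub>R y) \<le> (1 - t) * norm x + t * norm y"
      using norm_triangle_ineq[of "(1 - t) *\<^sub>R x" "t *\<^sub>R y"] t by simp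
    then have "norm ((1 - t) *\<^sub>R x + t *\<^sub>R y) - d \<le> (1 - t) * (norm x - d) + t * (norm y - d)"
      by (simp add: right_diff_distrib left_diff_distrib)
    also have "\<dots> \<le> (1 - t) * max 0 (norm x - d) + t * max 0 (norm y - d)"
      using t by (intro add_mono mult_left_mono) auto
    finally show "max 0 (norm ((1 - t) *\<^sub>R x + t *\<^sub>R y) - d)
        \<le> (1 - t) * max 0 (norm x - d) + t * max 0 (norm y - d)"
      using t by simp
  qed simp
  then have "convex_on UNIV (\<lambda>z :: real ^ 'n. 1/2 * (max 0 (norm z - d))\<^sup>2)"
    by (intro convex_on_cmul convex_on_power2) auto
  then show ?thesis
    by (subst beta_eq[OF assms, abs_def])
qed

lemma beta_le_alpha:
  fixes z :: "real ^ 'n"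
  assumes "d \<ge> 0"
  shows "beta d z \<le> alpha d z"
proof -
  \<comment> \<open>Shrinking the index set from ball to sphere raises the infimum, provided the
    sphere is nonempty; this holds because the dimension is at least 1.\<close>
  have "{y :: real ^ 'n. norm y = d} \<noteq> {}"
    using vector_choose_size[OF assms] by auto
  then show ?thesis
    unfolding alpha_def beta_def
    by (intro mult_left_mono cINF_superset_mono bdd_below_image_power2) auto
qed

lemma alpha_le_beta:
  fixes z :: "real ^ 'n"
  assumes "d \<ge> 0" "norm z > d"
  shows "alpha d z \<le> beta d z"
  using alpha_le[of "(d / norm z) *\<^sub>R z" d z] norm_diff_radial_projection[of d z] assms
  by (cases "z = 0") (auto simp: beta_eq)

lemma mem_antipodal_segment:
  fixes z :: "real ^ 'n"
  assumes "norm z \<le> d"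
  obtains a where "norm a = d" "z \<in> closed_segment (- a) a"
proof -
  \<comment> \<open>The antipodal points will be \<open>d *\<^sub>R u\<close> and its negative, on
    the line through \<open>z\<close> and the origin; for \<open>z = 0\<close> any direction
    \<open>u\<close> works.\<close>
  obtain u :: "real ^ 'n" where u: "norm u = 1" "z = norm z *\<^sub>R u"
  proof (cases "z = 0")
    case True
    then show ?thesis
      using that vector_choose_size[of 1] by (metis norm_zero scaleR_zero_left zero_le_one)
  next
    case False
    then show ?thesis
      using that[of "sgn z"] by (simp add: sgn_div_norm)
  qed
  show thesis
  \<comment> \<open>The parameter \<open>t\<close> below divides by \<open>d\<close>. For
    \<open>d = 0\<close> the ball is a single point and the segment is degenerate.\<close>
  proof (cases "d = 0")
    case True
    then show ?thesis
      using that[of 0] assms by simp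
  next
    case False
    then have d: "d > 0"
      using assms norm_ge_zero[of z] by linarith
    \<comment> \<open>This is the solution of \<open>(2 * t - 1) * d = norm z\<close>; the bound
      \<open>norm z \<le> d\<close> gives \<open>t \<le> 1\<close>.\<close>
    define t where "t = (1 + norm z / d) / 2"
    have t: "0 \<le> t" "t \<le> 1"
      using assms d by (auto simp: t_def)
    have "(1 - t) *\<^sub>R (- (d *\<^sub>R u)) + t *\<^sub>R (d *\<^sub>R u) = ((2 * t - 1) * d) *\<^sub>R u"
      by (simp add: algebra_simps flip: scaleR_add_left)
    also have "(2 * t - 1) * d = norm z"
      using d by (simp add: t_def field_simps)
    also have "norm z *\<^sub>R u = z"
      using u(2) by simp
    finally have "z \<in> closed_segment (- (d *\<^sub>R u)) (d *\<^sub>R u)"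
      using t by (auto simp: closed_segment_def)
    then show ?thesis
      using that[of "d *\<^sub>R u"] u(1) d by simp
  qed
qed

lemma convex_underestimator_le_beta:
  fixes \<eta> :: "real ^ 'n \<Rightarrow> real"
  assumes "d \<ge> 0" "\<eta> \<le> alpha d" "convex_on UNIV \<eta>"
  shows "\<eta> z \<le> beta d z"
proof (cases "norm z \<le> d")
  case True
  then obtain a where a: "norm a = d" "z \<in> closed_segment (- a) a"
    by (rule mem_antipodal_segment)
  then obtain t where t: "0 \<le> t" "t \<le> 1" "z = (1 - t) *\<^sub>R (- a) + t *\<^sub>R a"
    by (auto simp: closed_segment_def)
  have sphere: "\<eta> w \<le> 0" if "norm w = d" for w
    using le_funD[OF assms(2), of w] alpha_sphere[OF that] by linarith
  have "\<eta> z \<le> (1 - t) * \<eta> (- a) + t * \<eta> a"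
    unfolding t(3) using convex_onD[OF assms(3)] t by blast
  also have "\<dots> \<le> 0"
    using sphere a(1) t by (intro add_nonpos_nonpos mult_nonneg_nonpos) auto
  also have "0 \<le> beta d z"
    using assms(1) by (simp add: beta_eq)
  finally show ?thesis .
next
  case False
  then show ?thesis
    using le_funD[OF assms(2), of z] alpha_le_beta[OF assms(1), of z] by simp
qed

theorem mainTheorem4:
  fixes d :: real
  assumes "d \<ge> 0"
  shows "convex_envelope (alpha d :: real ^ 'n \<Rightarrow> real) = (\<lambda>z. ereal (beta d z))"
proof
  fix z :: "real ^ 'n"
  show "convex_envelope (alpha d) z = ereal (beta d z)"
    unfolding convex_envelope_def
  proof (rule antisym)
    show "(SUP \<eta> \<in> {\<eta>. \<eta> \<le> alpha d \<and> convex_on UNIV \<eta>}. ereal (\<eta> z)) \<le> ereal (beta d z)"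
      using convex_underestimator_le_beta[OF assms] by (intro SUP_least) auto
    \<comment> \<open>The supremum is attained: \<open>beta d\<close> is itself one of the competing
      convex underestimators.\<close>
    show "ereal (beta d z) \<le> (SUP \<eta> \<in> {\<eta>. \<eta> \<le> alpha d \<and> convex_on UNIV \<eta>}. ereal (\<eta> z))"
      using convex_on_beta[OF assms] beta_le_alpha[OF assms]
      by (intro SUP_upper) (auto simp: le_fun_def)
  qed
qed

end
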